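(* Let $\lambda_i\in\mathbb{R}_+$, $i\in\mathbb{N}$, be such that $\sum_{i=1}^\infty\lambda_i=1$. Let $d\in\mathbb{N}$, let $D\subseteq\mathbb{R}^d$ be a convex set, and let $x_i\in D$, $i\in\mathbb{N}$, be such that $\sum_{i=1}^\infty\lambda_i\Vert x_i\Vert<\infty$. Then, for any convex function $f:D\to\mathbb{R}$, we have that $$f\left(\sum_{i=1}^\infty\lambda_i x_i\right)\leq\sum_{i=1}^\infty\lambda_i f(x_i).$$
   Context: $\mathbb{N}$ denotes the set of positive integers, $\mathbb{R}_+$ the set of non-negative real numbers, and $\Vert\cdot\Vert$ the Euclidean norm on $\mathbb{R}^d$. A function $f:D\to\mathbb{R}$ on a nonempty convex set $D\subseteq\mathbb{R}^d$ is called convex if $f(tx+(1-t)y)\leq tf(x)+(1-t)f(y)$ for all $x,y\in D$ and all $t\in(0,1)$. No continuity of $f$ is assumed, and $D$ is not assumed to be open, closed or bounded. The inequality is understood as including that both of its sides are meaningful: the (absolutely convergent) sum $\sum_{i=1}^\infty\lambda_i x_i$ belongs to $D$, and the right-hand side is a well-defined element of $(-\infty,\infty]$, namely the series either converges to a real number or diverges to $+\infty$ (in the latter case the inequality holds trivially). *)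

theory Defs
  imports "HOL-Analysis.Analysis"
begin

end

theory Submission
  imports Defs
begin

text \<open>
  The barycenter \<open>m\<close> of the points lies in the relative interior of the convex hull \<open>C\<close> of the
  points of positive weight: otherwise a hyperplane through \<open>m\<close> supports \<open>C\<close> without containing
  it, and averaging the strict one-sided inequality contradicts the definition of \<open>m\<close>. At a
  relative interior point every convex function on \<open>C\<close>, continuous or not, has an affine
  minorant which is exact there; integrating this minorant gives the inequality.
\<close>

text \<open>The point \<open>(m, f m)\<close> is on the relative boundary of the epigraph, so a
  hyperplane supports the epigraph there. As \<open>m\<close> is relatively interior to
  \<open>C\<close>, that hyperplane is not vertical, and its slope is the subgradient.\<close>

lemma subgradient_exists_rel_interior:
  fixes f :: "'a::euclidean_space \<Rightarrow> real"
  assumes f: "convex_on C f" and m: "m \<in> rel_interior C"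
  obtains v where "\<And>y. y \<in> C \<Longrightarrow> f m + v \<bullet> (y - m) \<le> f y"
proof -
  have C: "convex C" using f by (rule convex_on_imp_convex)
  have mC: "m \<in> C" using m rel_interior_subset by blast
  let ?E = "epigraph C f"
  have E: "convex ?E" using f C by (simp add: convex_epigraph)
  have mE: "(m, f m) \<in> ?E" using mC by (simp add: mem_epigraph)
  \<comment> \<open>From a relative interior point, the segment coming down from
    \<open>(m, f m + 1)\<close> could be prolonged below the graph.\<close>
  have "(m, f m) \<notin> rel_interior ?E"
  proof
    assume "(m, f m) \<in> rel_interior ?E"
    moreover have "(m, f m + 1) \<in> ?E" using mC by (simp add: mem_epigraph)
    ultimately obtain e where "e > 1" and e: "(1 - e) *\<^sub>R (m, f m + 1) + e *\<^sub>R (m, f m) \<in> ?E"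
      using convex_rel_interior_iff[OF E] mE by blast
    have "(1 - e) *\<^sub>R (m, f m + 1) + e *\<^sub>R (m, f m) = (m, f m + 1 - e)"
      by (simp add: algebra_simps)
    with e \<open>e > 1\<close> show False by (simp add: mem_epigraph)
  qed
  then obtain w where le: "\<And>p. p \<in> ?E \<Longrightarrow> w \<bullet> (m, f m) \<le> w \<bullet> p"
    and less: "\<And>p. p \<in> rel_interior ?E \<Longrightarrow> w \<bullet> (m, f m) < w \<bullet> p"
    by (rule supporting_hyperplane_rel_boundary[OF E mE]) blast
  obtain a b where w: "w = (a, b)" by (cases w)
  have le': "a \<bullet> m + b * f m \<le> a \<bullet> y + b * t" if "y \<in> C" "f y \<le> t" for y t
    using le[of "(y, t)"] that by (simp add: w mem_epigraph)
  have "b \<ge> 0" using le'[OF mC, of "f m + 1"] by (simp add: algebra_simps)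
  moreover have "b \<noteq> 0"
  proof
    assume "b = 0"
    \<comment> \<open>A vertical hyperplane gives \<open>a \<bullet> m\<close> as the minimum of
      \<open>a\<close> over \<open>C\<close>. Prolonging the segment from \<open>y\<close> slightly
      past \<open>m\<close> makes it the maximum too, against strictness on the relative interior of
      the epigraph.\<close>
    have ge: "a \<bullet> y \<le> a \<bullet> m" if y: "y \<in> C" for y
    proof -
      obtain e where "e > 1" and e: "(1 - e) *\<^sub>R y + e *\<^sub>R m \<in> C"
        using convex_rel_interior_iff[OF C, of m] m y by blast
      have "a \<bullet> m \<le> a \<bullet> ((1 - e) *\<^sub>R y + e *\<^sub>R m)"
        using le'[OF e order_refl] \<open>b = 0\<close> by simp
      then have "0 \<le> (e - 1) * (a \<bullet> m - a \<bullet> y)"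
        by (simp add: inner_add_right algebra_simps)
      with \<open>e > 1\<close> show ?thesis by (simp add: zero_le_mult_iff)
    qed
    have "rel_interior ?E \<noteq> {}" using rel_interior_eq_empty[OF E] mE by blast
    then obtain y t where yt: "(y, t) \<in> rel_interior ?E" by auto
    then have "y \<in> C" using rel_interior_subset by (fastforce simp: mem_epigraph)
    with less[OF yt] ge show False by (fastforce simp: w \<open>b = 0\<close>)
  qed
  ultimately have "b > 0" by simp
  show thesis
  proof (rule that)
    fix y assume "y \<in> C"
    from le'[OF this order_refl] \<open>b > 0\<close>
    show "f m + (- a /\<^sub>R b) \<bullet> (y - m) \<le> f y"
      by (simp add: inner_diff_right field_simps)
  qed
qed

text \<open>The weighted deviations \<open>l i * (a \<bullet> x i - a \<bullet> m)\<close> are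
  nonnegative and sum to zero, so each of them vanishes.\<close>

lemma barycenter_one_sided_eq:
  fixes x :: "nat \<Rightarrow> 'a::real_inner"
  assumes l: "\<And>i. l i \<ge> 0" "l sums 1" and m: "(\<lambda>i. l i *\<^sub>R x i) sums m"
    and le: "\<And>i. l i > 0 \<Longrightarrow> a \<bullet> m \<le> a \<bullet> x i" and i: "l i > 0"
  shows "a \<bullet> x i = a \<bullet> m"
proof -
  let ?h = "\<lambda>i. l i * (a \<bullet> x i - a \<bullet> m)"
  have "(\<lambda>i. a \<bullet> (l i *\<^sub>R x i) - l i * (a \<bullet> m)) sums (a \<bullet> m - 1 * (a \<bullet> m))"
    by (intro sums_diff sums_mult2 l bounded_linear.sums[OF bounded_linear_inner_right m])
  then have "?h sums 0" by (simp add: algebra_simps)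
  then have "summable ?h" "suminf ?h = 0" by (simp_all only: sums_iff)
  moreover have "?h i \<ge> 0" for i
    using l(1)[of i] le[of i] by (cases "l i = 0") auto
  ultimately have "?h i = 0"
    using suminf_eq_zero_iff[of ?h] by blast
  with i show ?thesis by simp
qed

text \<open>The hull is taken over positive weights only: a point of weight zero could enlarge it so
  that \<open>m\<close> falls on its relative boundary.\<close>

lemma barycenter_in_rel_interior:
  fixes x :: "nat \<Rightarrow> 'a::euclidean_space"
  assumes l: "\<And>i. l i \<ge> 0" "l sums 1" and m: "(\<lambda>i. l i *\<^sub>R x i) sums m"
  shows "m \<in> rel_interior (convex hull (x ` {i. l i > 0}))" (is "m \<in> rel_interior ?C")
proof (rule ccontr)
  assume notin: "m \<notin> rel_interior ?C"
  have xC: "x i \<in> ?C" if "l i > 0" for i using that by (auto intro: hull_inc)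
  obtain k where k: "l k > 0"
  proof -
    have "\<exists>k. l k \<noteq> 0"
    proof (rule ccontr)
      assume "\<nexists>k. l k \<noteq> 0"
      then have "l = (\<lambda>_. 0)" by auto
      with l(2) show False by (metis sums_unique2 sums_zero zero_neq_one)
    qed
    with that l(1) show thesis by (metis less_eq_real_def)
  qed
  \<comment> \<open>The supporting hyperplane below requires this. Strict separation of
    \<open>m\<close> from the closure would put every \<open>x i\<close> of positive weight strictly
    on one side of \<open>m\<close>.\<close>
  have "m \<in> closure ?C"
  proof (rule ccontr)
    assume "m \<notin> closure ?C"
    then obtain a b where ab: "a \<bullet> m < b" "\<And>y. y \<in> closure ?C \<Longrightarrow> b < a \<bullet> y"
      using separating_hyperplane_closed_point[of "closure ?C" m]
      by (auto simp: convex_closure)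
    have less: "a \<bullet> m < a \<bullet> x i" if "l i > 0" for i
      using ab xC[OF that] closure_subset by fastforce
    then have "a \<bullet> x k = a \<bullet> m"
      by (intro barycenter_one_sided_eq[of l x m, OF l m _ k]) (simp add: less_imp_le)
    with less[OF k] show False by simp
  qed
  then obtain a where le: "\<And>y. y \<in> closure ?C \<Longrightarrow> a \<bullet> m \<le> a \<bullet> y"
    and less: "\<And>y. y \<in> rel_interior ?C \<Longrightarrow> a \<bullet> m < a \<bullet> y"
    using notin by (rule supporting_hyperplane_relative_frontier[OF convex_convex_hull]) blast
  have "a \<bullet> x i = a \<bullet> m" if "l i > 0" for i
  proof (rule barycenter_one_sided_eq[of l x m, OF l m _ that])
    show "a \<bullet> m \<le> a \<bullet> x i" if "l i > 0" for i
      using le xC[OF that] closure_subset by blast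
  qed
  then have "x ` {i. l i > 0} \<subseteq> {y. a \<bullet> y = a \<bullet> m}" by auto
  then have eq: "?C \<subseteq> {y. a \<bullet> y = a \<bullet> m}" by (intro hull_minimal convex_hyperplane)
  have "rel_interior ?C \<noteq> {}"
    using k rel_interior_eq_empty[of ?C] by auto
  then obtain y where y: "y \<in> rel_interior ?C" by blast
  then have "a \<bullet> y = a \<bullet> m" using eq rel_interior_subset by blast
  with less[OF y] show False by simp
qed

text \<open>The differences \<open>h i - g i\<close> are nonnegative, so they have a sum in
  [0, \<infinity>]; adding back the finite \<open>c\<close> never meets \<infinity> -
  \<infinity>.\<close>

lemma sums_ereal_minorant:
  fixes g h :: "nat \<Rightarrow> real"
  assumes g: "g sums c" and le: "\<And>i. g i \<le> h i"
  obtains S :: ereal where "(\<lambda>i. ereal (h i)) sums S" "S \<noteq> - \<infinity>" "ereal c \<le> S"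
proof -
  let ?d = "\<lambda>i. ereal (h i - g i)"
  have nonneg: "?d i \<ge> 0" for i using le[of i] by simp
  have "?d sums suminf ?d"
    using nonneg by (intro summable_sums summable_ereal_pos)
  moreover have "(\<lambda>i. ereal (g i)) sums ereal c" using g by (simp add: sums_ereal)
  moreover have pos: "0 \<le> suminf ?d" using nonneg by (intro suminf_0_le) auto
  ultimately have "(\<lambda>n. (\<Sum>i<n. ?d i) + (\<Sum>i<n. ereal (g i))) \<longlonglongrightarrow> suminf ?d + ereal c"
    unfolding sums_def by (intro tendsto_add_ereal_general) auto
  then have "(\<lambda>i. ereal (h i)) sums (suminf ?d + ereal c)"
    by (simp add: sums_def sum.distrib[symmetric])
  moreover have "suminf ?d + ereal c \<noteq> - \<infinity>" "ereal c \<le> suminf ?d + ereal c"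
    using pos by (cases "suminf ?d"; simp)+
  ultimately show thesis by (rule that)
qed

theorem proposition3p1:
  fixes l :: "nat \<Rightarrow> real"
    and D :: "(real ^ 'd) set"
    and x :: "nat \<Rightarrow> real ^ 'd"
    and f :: "real ^ 'd \<Rightarrow> real"
  assumes "\<And>i. l i \<ge> 0"
    and "l sums 1"
    and "convex D"
    and "\<And>i. x i \<in> D"
    and "summable (\<lambda>i. l i * norm (x i))"
    and "convex_on D f"
  shows "summable (\<lambda>i. norm (l i *\<^sub>R x i))
    \<and> (\<Sum>i. l i *\<^sub>R x i) \<in> D
    \<and> (\<exists>S::ereal. (\<lambda>i. ereal (l i * f (x i))) sums S \<and> S \<noteq> - \<infinity>
          \<and> ereal (f (\<Sum>i. l i *\<^sub>R x i)) \<le> S)"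
proof -
  define m where "m = (\<Sum>i. l i *\<^sub>R x i)"
  define C where "C = convex hull (x ` {i. l i > 0})"
  have summable: "summable (\<lambda>i. norm (l i *\<^sub>R x i))" using assms(1,5) by simp
  have m: "(\<lambda>i. l i *\<^sub>R x i) sums m"
    unfolding m_def using summable by (rule summable_sums[OF summable_norm_cancel])
  have CD: "C \<subseteq> D" unfolding C_def using assms(3,4) by (intro hull_minimal) auto
  have mC: "m \<in> rel_interior C"
    unfolding C_def by (rule barycenter_in_rel_interior[OF assms(1,2) m])
  \<comment> \<open>Membership comes from the hull itself, not from a limit of points of
    \<open>D\<close>.\<close>
  then have "m \<in> D" using CD rel_interior_subset by blast
  have "convex_on C f"
    using assms(6) CD by (rule convex_on_subset) (simp add: C_def)
  then obtain v where v: "\<And>y. y \<in> C \<Longrightarrow> f m + v \<bullet> (y - m) \<le> f y"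
    using mC by (rule subgradient_exists_rel_interior) blast
  \<comment> \<open>Averaging the affine minorant returns its value at the barycenter, which is
    \<open>f m\<close>.\<close>
  have "(\<lambda>i. l i * (f m - v \<bullet> m) + v \<bullet> (l i *\<^sub>R x i)) sums (1 * (f m - v \<bullet> m) + v \<bullet> m)"
    by (intro sums_add sums_mult2 assms(2) bounded_linear.sums[OF bounded_linear_inner_right m])
  then have "(\<lambda>i. l i * (f m + v \<bullet> (x i - m))) sums f m"
    by (simp add: algebra_simps)
  \<comment> \<open>A point of weight zero may lie outside \<open>C\<close>, where the minorant can
    fail, but then both sides are 0.\<close>
  moreover have "l i * (f m + v \<bullet> (x i - m)) \<le> l i * f (x i)" for i
  proof (cases "l i > 0")
    case True
    then have "x i \<in> C" unfolding C_def by (auto intro: hull_inc)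
    with v True show ?thesis by (simp add: mult_left_mono)
  next
    case False
    with assms(1)[of i] show ?thesis by simp
  qed
  ultimately obtain S :: ereal where "(\<lambda>i. ereal (l i * f (x i))) sums S" "S \<noteq> - \<infinity>" "ereal (f m) \<le> S"
    by (rule sums_ereal_minorant)
  with summable \<open>m \<in> D\<close> show ?thesis unfolding m_def by blast
qed

end
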